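(* Let $S$ be a semigroup and let $\sigma:S\to S$ be an involutive morphism. Let $\mu$ be a complex measure that is a linear combination of Dirac measures $(\delta_{z_i})_{i\in I}$ such that $z_i$ is contained in the center of $S$ for all $i\in I$. Let $\delta>0$ be fixed. If $f:S\to\mathbb{C}$ satisfies $$\left|\int_S f(x\sigma(y)t)\,d\mu(t)-\int_S f(xyt)\,d\mu(t)-2f(x)f(y)\right|\leq\delta\quad\text{for all }x,y\in S,$$ then either $f$ is bounded and $$|f(x)|\leq\frac{\|\mu\|+\sqrt{\|\mu\|^2+2\delta}}{2}\quad\text{for all }x\in S,$$ or $f$ satisfies $$\int_S f(x\sigma(y)t)\,d\mu(t)-\int_S f(xyt)\,d\mu(t)=2f(x)f(y)\quad\text{for all }x,y\in S.$$
   Context: A semigroup is a set with an associative operation, written multiplicatively. An involutive morphism of $S$ is a map $\sigma:S\to S$ with $\sigma(\sigma(x))=x$ for all $x\in S$ that is either an automorphism ($\sigma(xy)=\sigma(x)\sigma(y)$ for all $x,y\in S$) or an anti-automorphism ($\sigma(xy)=\sigma(y)\sigma(x)$ for all $x,y\in S$). The measure is $\mu=\sum_{i\in I}\alpha_i\delta_{z_i}$ (finite linear combination, $\alpha_i\in\mathbb{C}$), so $\int_S h(t)\,d\mu(t)=\sum_i\alpha_i h(z_i)$; $\|\mu\|$ denotes its total variation norm. *)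

theory Defs
  imports "HOL-Probability.Giry_Monad" "HOL-Library.Disjoint_Sets"
begin

definition involutive_morphism :: "('a::semigroup_mult \<Rightarrow> 'a) \<Rightarrow> bool" where
  "involutive_morphism \<sigma> \<longleftrightarrow>
     (\<forall>x. \<sigma> (\<sigma> x) = x) \<and>
     ((\<forall>x y. \<sigma> (x * y) = \<sigma> x * \<sigma> y) \<or> (\<forall>x y. \<sigma> (x * y) = \<sigma> y * \<sigma> x))"

definition semigroup_center :: "'a::semigroup_mult set" where
  "semigroup_center = {z. \<forall>x. z * x = x * z}"

(* The complex measure sum_i alpha_i delta_(z_i), as a set function on all subsets.
   The points z_i need not be distinct. *)
definition dirac_comb :: "'i set \<Rightarrow> ('i \<Rightarrow> complex) \<Rightarrow> ('i \<Rightarrow> 'a) \<Rightarrow> 'a set \<Rightarrow> complex" where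
  "dirac_comb I \<alpha> z A =
     (\<Sum>i\<in>I. \<alpha> i * complex_of_real (measure (return (count_space UNIV) (z i)) A))"

definition dirac_comb_integral ::
    "'i set \<Rightarrow> ('i \<Rightarrow> complex) \<Rightarrow> ('i \<Rightarrow> 'a) \<Rightarrow> ('a \<Rightarrow> complex) \<Rightarrow> complex" where
  "dirac_comb_integral I \<alpha> z h = (\<Sum>i\<in>I. \<alpha> i * h (z i))"

lemma dirac_comb_integral_eq_LINT:
  "dirac_comb_integral I \<alpha> z h =
     (\<Sum>i\<in>I. \<alpha> i * (LINT t|return (count_space UNIV) (z i). h t))"
  unfolding dirac_comb_integral_def by (simp add: integral_return)

(* Every subset is measurable, so the supremum is over all finite partitions of the
   whole space. As a supremum of reals it is meaningful when these sums are bounded,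
   which they are for dirac_comb. If some z_i coincide, the value can be smaller than
   the sum of the norms of the alpha_i. *)
definition total_variation :: "('a set \<Rightarrow> complex) \<Rightarrow> real" where
  "total_variation \<mu> =
     (SUP P\<in>{P. finite P \<and> partition_on UNIV P}. \<Sum>A\<in>P. norm (\<mu> A))"

lemma norm_sum_dirac_comb_le:
  assumes "finite P" "partition_on UNIV P"
  shows "(\<Sum>A\<in>P. norm (dirac_comb I \<alpha> z A)) \<le> (\<Sum>i\<in>I. norm (\<alpha> i))"
proof -
  have meas: "measure (return (count_space UNIV) (z i)) A = indicator A (z i)" for i A
    by (simp add: measure_return)
  have one: "(\<Sum>A\<in>P. indicator A x) = (1::real)" for x
  proof -
    obtain B where B: "B \<in> P" "x \<in> B"
      using assms(2) unfolding partition_on_def by blast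
    have "indicator A x = (if A = B then 1 else (0::real))" if "A \<in> P" for A
      using that B assms(2) unfolding partition_on_def disjoint_def
      by (auto simp: indicator_def)
    then have "(\<Sum>A\<in>P. indicator A x) = (\<Sum>A\<in>P. if A = B then 1 else (0::real))"
      by (intro sum.cong) auto
    also have "\<dots> = 1"
      using assms(1) B by simp
    finally show ?thesis .
  qed
  have "(\<Sum>A\<in>P. norm (dirac_comb I \<alpha> z A)) \<le> (\<Sum>A\<in>P. \<Sum>i\<in>I. norm (\<alpha> i) * indicator A (z i))"
    unfolding dirac_comb_def meas
    by (intro sum_mono order.trans[OF norm_sum]) (simp add: norm_mult)
  also have "\<dots> = (\<Sum>i\<in>I. norm (\<alpha> i) * (\<Sum>A\<in>P. indicator A (z i)))"
    by (subst sum.swap) (simp add: sum_distrib_left)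
  finally show ?thesis by (simp add: one)
qed

end

(* Let F x be the integral of f(xt) d\<mu>(t), and suppose f is unbounded. Errors that stay bounded while
   one argument w varies disappear after division by f w. This gives first that f is odd under \<sigma>,
   and then, by expanding f(w) F(\<sigma> u) and f(w) F(u) with the approximate equation, that
   F(\<sigma> u) - F(u) = c f(u) for a constant c. Once c = 0 is known, expanding
   f(w) (F(x \<sigma>(y)) - F(x y)) in the same way turns it into 2 f(w) f(x) f(y) up to a bounded error,
   and letting w vary yields the exact equation.

   To exclude c \<noteq> 0 for an automorphism, compare F(\<sigma> u) - F(u) at u = xy and u = x \<sigma>(y): the function
   f(xy) - f(x \<sigma>(y)), hence f(x) f(y), would be bounded. For an anti-automorphism the relation controls
   F(yx) - F(xy); computing F(ayx) - F(a \<sigma>(y) x) once by moving x to the left and once by applying the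
   equation at yx and \<sigma>(y) x forces f(xy) - f(x \<sigma>(y)) = f(\<sigma>(y) x) - f(yx). Integrating this gives
   F = (c/2) f, which is odd under \<sigma>, and therefore c = 0.

   For bounded f, taking x = y gives B^2 \<le> \<delta>/2 + v B with B = sup |f| and v the total variation. *)

theory Submission
  imports Defs
begin

section \<open>Bounded families and cancellation of an unbounded factor\<close>

lemma bounded_range_cmult:
  fixes g :: "'b \<Rightarrow> complex"
  assumes "bounded (range g)"
  shows "bounded (range (\<lambda>a. k * g a))"
proof -
  obtain C where "\<And>a. norm (g a) \<le> C"
    using assms unfolding bounded_iff by auto
  then have "norm (k * g a) \<le> norm k * C" for a
    by (simp add: norm_mult mult_left_mono)
  then show ?thesis
    unfolding bounded_iff by blast
qed

lemma bounded_range_weighted_sum: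
  fixes g :: "'i \<Rightarrow> 'b \<Rightarrow> complex"
  assumes "\<And>i. i \<in> I \<Longrightarrow> bounded (range (g i))"
  shows "bounded (range (\<lambda>a. \<Sum>i\<in>I. \<alpha> i * g i a))"
  using assms
  by (induction I rule: infinite_finite_induct)
    (auto intro!: bounded_plus_comp bounded_range_cmult simp: image_constant_conv)

lemma unbounded_mult_const_eq_0:
  fixes f :: "'b \<Rightarrow> complex"
  assumes "\<not> bounded (range f)" "bounded (range (\<lambda>a. f a * k))"
  shows "k = 0"
proof (rule ccontr)
  assume "k \<noteq> 0"
  with bounded_range_cmult[OF assms(2), of "inverse k"] assms(1) show False
    by (simp add: field_simps)
qed

section \<open>The approximate equation for an unbounded function\<close>

locale van_vleck_superstability =
  fixes \<sigma> :: "'a::semigroup_mult \<Rightarrow> 'a"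
    and I :: "'i set" and \<alpha> :: "'i \<Rightarrow> complex" and z :: "'i \<Rightarrow> 'a"
    and \<delta> :: real and f :: "'a \<Rightarrow> complex"
  assumes morphism: "involutive_morphism \<sigma>"
    and center: "\<And>i. i \<in> I \<Longrightarrow> z i \<in> semigroup_center"
    and approx: "\<And>x y. norm (dirac_comb_integral I \<alpha> z (\<lambda>t. f (x * \<sigma> y * t))
                 - dirac_comb_integral I \<alpha> z (\<lambda>t. f (x * y * t)) - 2 * f x * f y) \<le> \<delta>"
    and unbounded: "\<not> bounded (range f)"
begin

definition F :: "'a \<Rightarrow> complex" where
  "F x = (\<Sum>i\<in>I. \<alpha> i * f (x * z i))"

definition err :: "'a \<Rightarrow> 'a \<Rightarrow> complex" where
  "err x y = F (x * \<sigma> y) - F (x * y) - 2 * f x * f y"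

lemma F_eq: "F (x * \<sigma> y) = F (x * y) + 2 * f x * f y + err x y"
  by (simp add: err_def)

text \<open>The bound \<delta> is uniform in both arguments, so \<open>p\<close> and
  \<open>q\<close> may depend on \<open>a\<close> in any way. Boundedness below is mostly shown by
  rewriting an expression through values of \<open>err\<close>.\<close>

lemma bounded_err: "bounded (range (\<lambda>a. err (p a) (q a)))"
  using approx unfolding bounded_iff err_def F_def dirac_comb_integral_def by blast

lemmas bounded_intros =
  bounded_plus_comp bounded_minus_comp bounded_range_cmult bounded_range_weighted_sum bounded_err

lemma involution [simp]: "\<sigma> (\<sigma> x) = x"
  using morphism by (simp add: involutive_morphism_def)

lemma z_commute: "i \<in> I \<Longrightarrow> z i * x = x * z i"
  using center by (simp add: semigroup_center_def)

lemma sigma_z_commute: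
  assumes "i \<in> I"
  shows "\<sigma> (z i) * x = x * \<sigma> (z i)"
  by (metis assms involution involutive_morphism_def morphism z_commute)

lemma sigma_mult_z: "i \<in> I \<Longrightarrow> \<sigma> (x * z i) = \<sigma> x * \<sigma> (z i)"
  using morphism sigma_z_commute by (auto simp: involutive_morphism_def)

text \<open>Centrality moves \<open>z i\<close> to the middle. An identity for
  \<open>f (x * y)\<close> can thus be integrated in \<open>x\<close>: put \<open>x * z i\<close>
  for \<open>x\<close>, multiply by \<open>\<alpha> i\<close> and sum.\<close>

lemma F_mult: "F (x * y) = (\<Sum>i\<in>I. \<alpha> i * f (x * z i * y))"
  unfolding F_def by (intro sum.cong refl) (simp add: mult.assoc z_commute)

lemma eq_0_if_bounded: "bounded (range (\<lambda>a. f a * k)) \<Longrightarrow> k = 0"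
  using unbounded_mult_const_eq_0[OF unbounded] .

lemma f_sigma: "f (\<sigma> y) = - f y"
proof -
  \<comment> \<open>Replacing \<open>y\<close> by \<open>\<sigma> y\<close> reverses the sign of the
    difference of \<open>F\<close> values in \<open>err a y\<close>, so only the products survive in
    the sum.\<close>
  have "bounded (range (\<lambda>a. (-1/2) * (err a y + err a (\<sigma> y))))"
    by (intro bounded_intros)
  also have "(\<lambda>a. (-1/2) * (err a y + err a (\<sigma> y))) = (\<lambda>a. f a * (f y + f (\<sigma> y)))"
    by (simp add: err_def algebra_simps fun_eq_iff)
  finally have "f y + f (\<sigma> y) = 0"
    by (rule eq_0_if_bounded)
  then show ?thesis
    by (simp add: add_eq_0_iff)
qed

section \<open>Comparison of \<open>F\<close> with its composition with \<sigma>\<close>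

lemma f_sigma_mult_z: "i \<in> I \<Longrightarrow> f (\<sigma> x * z i) = - f (x * \<sigma> (z i))"
  by (metis f_sigma involution sigma_mult_z)

text \<open>Oddness of \<open>f\<close> trades \<sigma> on \<open>x\<close> for \<sigma> on the
  points \<open>z i\<close>. Sums over \<open>\<sigma> (z i)\<close>, which arise when \<sigma>
  falls on a factor \<open>z i\<close>, can so be read as values of \<open>F\<close>.\<close>

lemma F_sigma: "F (\<sigma> x) = - (\<Sum>i\<in>I. \<alpha> i * f (x * \<sigma> (z i)))"
  by (simp add: F_def f_sigma_mult_z sum_negf)

lemma f_cross_bounded:
  "bounded (range (\<lambda>w. f w * (F (\<sigma> u) - F u) - f u * (F (\<sigma> w) - F w)))"
proof -
  \<comment> \<open>The four errors are chosen so that their eight \<open>F\<close> terms cancel in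
    pairs. This uses \<open>sigma_mult_z\<close>, which holds for both kinds of morphism because
    \<open>z i\<close> is central.\<close>
  have eq: "2 * f w * f (\<sigma> u * z i) - 2 * f w * f (u * z i)
      + 2 * f u * f (w * z i) + 2 * f u * f (w * \<sigma> (z i))
    = err w (u * z i) - err w (\<sigma> u * z i) - err (w * z i) u - err (w * \<sigma> (z i)) u"
    if "i \<in> I" for w i
    using that
    by (simp add: err_def sigma_mult_z mult.assoc z_commute sigma_z_commute)
  have "bounded (range (\<lambda>w. (1/2) * (\<Sum>i\<in>I. \<alpha> i * (err w (u * z i) - err w (\<sigma> u * z i)
      - err (w * z i) u - err (w * \<sigma> (z i)) u))))"
    by (intro bounded_intros)
  also have "(\<lambda>w. (1/2) * (\<Sum>i\<in>I. \<alpha> i * (err w (u * z i) - err w (\<sigma> u * z i)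
      - err (w * z i) u - err (w * \<sigma> (z i)) u)))
    = (\<lambda>w. f w * (F (\<sigma> u) - F u) - f u * (F (\<sigma> w) - F w))"
  proof
    fix w
    have "(\<Sum>i\<in>I. \<alpha> i * (err w (u * z i) - err w (\<sigma> u * z i)
      - err (w * z i) u - err (w * \<sigma> (z i)) u))
      = (\<Sum>i\<in>I. \<alpha> i * (2 * f w * f (\<sigma> u * z i) - 2 * f w * f (u * z i)
      + 2 * f u * f (w * z i) + 2 * f u * f (w * \<sigma> (z i))))"
      using eq by (intro sum.cong) auto
    also have "\<dots> = 2 * (f w * (F (\<sigma> u) - F u) - f u * (F (\<sigma> w) - F w))"
      unfolding F_sigma[of w] unfolding F_def
      by (simp add: sum_distrib_left algebra_simps sum.distrib sum_subtractf)
    finally show "(1/2) * (\<Sum>i\<in>I. \<alpha> i * (err w (u * z i) - err w (\<sigma> u * z i)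
      - err (w * z i) u - err (w * \<sigma> (z i)) u))
      = f w * (F (\<sigma> u) - F u) - f u * (F (\<sigma> w) - F w)" by simp
  qed
  finally show ?thesis .
qed

lemma F_sigma_diff_proportional:
  "\<exists>c. \<forall>u. F (\<sigma> u) = F u + c * f u"
proof -
  obtain v where v: "f v \<noteq> 0"
  proof (rule ccontr)
    assume "\<not> thesis"
    then have "f = (\<lambda>_. 0)"
      using that by blast
    then show False
      using unbounded by (simp add: image_constant_conv)
  qed
  define c where "c = (F (\<sigma> v) - F v) / f v"
  have "F (\<sigma> u) - (F u + c * f u) = 0" for u
  proof (rule eq_0_if_bounded)
    \<comment> \<open>Subtracting \<open>f u / f v\<close> times the relation for \<open>v\<close>
      eliminates \<open>F (\<sigma> w) - F w\<close> and leaves \<open>f w\<close> times a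
      constant.\<close>
    have "bounded (range (\<lambda>w. (f w * (F (\<sigma> u) - F u) - f u * (F (\<sigma> w) - F w))
        - (f u / f v) * (f w * (F (\<sigma> v) - F v) - f v * (F (\<sigma> w) - F w))))"
      by (intro bounded_intros f_cross_bounded)
    then show "bounded (range (\<lambda>w. f w * (F (\<sigma> u) - (F u + c * f u))))"
      using v by (simp add: c_def field_simps)
  qed
  then have "F (\<sigma> u) = F u + c * f u" for u
    by simp
  then show ?thesis
    by blast
qed

section \<open>Automorphisms: \<open>F\<close> is invariant under \<sigma>\<close>

lemma F_sigma_automorphism:
  assumes hom: "\<And>x y. \<sigma> (x * y) = \<sigma> x * \<sigma> y"
  shows "F (\<sigma> u) = F u"
proof -
  obtain c where c: "\<And>u. F (\<sigma> u) = F u + c * f u"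
    using F_sigma_diff_proportional by blast
  \<comment> \<open>The product terms of the two errors cancel because \<open>f\<close> is
    odd.\<close>
  have eq: "c * (f (x * y) - f (x * \<sigma> y)) = err (\<sigma> x) y + err x y" for x y
    using c[of "x * y"] c[of "x * \<sigma> y"] by (simp add: err_def hom f_sigma algebra_simps)
  have "c * f y = 0" for y
  proof (rule eq_0_if_bounded)
    \<comment> \<open>Integrating \<open>eq\<close> in \<open>x\<close> gives
      \<open>c * (F (x * y) - F (x * \<sigma> y))\<close>; adding \<open>c * err x y\<close> leaves
      \<open>- 2 * c * f x * f y\<close>.\<close>
    have "bounded (range (\<lambda>x. (-1/2) * ((\<Sum>i\<in>I. \<alpha> i * (err (\<sigma> (x * z i)) y + err (x * z i) y))
        + c * err x y)))"
      by (intro bounded_intros)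
    also have "(\<lambda>x. (-1/2) * ((\<Sum>i\<in>I. \<alpha> i * (err (\<sigma> (x * z i)) y + err (x * z i) y))
        + c * err x y)) = (\<lambda>x. f x * (c * f y))"
    proof
      fix x
      have "(\<Sum>i\<in>I. \<alpha> i * (err (\<sigma> (x * z i)) y + err (x * z i) y))
        = c * (F (x * y) - F (x * \<sigma> y))"
        unfolding eq[symmetric] F_mult
        by (simp add: sum_distrib_left right_diff_distrib sum_subtractf ac_simps)
      then show "(-1/2) * ((\<Sum>i\<in>I. \<alpha> i * (err (\<sigma> (x * z i)) y + err (x * z i) y))
        + c * err x y) = f x * (c * f y)"
        by (simp add: err_def algebra_simps)
    qed
    finally show "bounded (range (\<lambda>x. f x * (c * f y)))" .
  qed
  then show ?thesis
    using c by simp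
qed

section \<open>Anti-automorphisms: \<open>F\<close> is invariant under \<sigma>\<close>

lemma F_swap:
  assumes anti: "\<And>x y. \<sigma> (x * y) = \<sigma> y * \<sigma> x"
    and c: "\<And>u. F (\<sigma> u) = F u + c * f u"
  shows "F (y * x) = F (x * y) + c * f (x * \<sigma> y) + err x y - err y x"
  \<comment> \<open>Since \<open>\<sigma> (x * \<sigma> y) = y * \<sigma> x\<close>, both
    \<open>F\<close> terms of \<open>c\<close> expand by the approximate equation, and their
    products \<open>2 * f x * f y\<close> cancel.\<close>
  using c[of "x * \<sigma> y"] by (simp add: err_def anti)

text \<open>The equation with first argument \<open>a\<close> takes \<open>y * x\<close> to
  \<open>\<sigma> x * \<sigma> y\<close> and \<open>\<sigma> y * x\<close> to
  \<open>\<sigma> x * y\<close>. The two results differ by the equation at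
  \<open>a * \<sigma> x\<close> and \<open>y\<close>.\<close>

lemma F_shift_left:
  assumes anti: "\<And>x y. \<sigma> (x * y) = \<sigma> y * \<sigma> x"
  shows "F (a * y * x) - F (a * \<sigma> y * x)
    = 2 * f (a * \<sigma> x) * f y - 2 * f a * (f (y * x) - f (\<sigma> y * x))
      + err (a * \<sigma> x) y - err a (y * x) + err a (\<sigma> y * x)"
  by (simp add: err_def anti mult.assoc algebra_simps)

lemma f_sigma_left:
  assumes anti: "\<And>x y. \<sigma> (x * y) = \<sigma> y * \<sigma> x"
  shows "f (\<sigma> x * y) = - f (\<sigma> y * x)" "f (x * \<sigma> y) = - f (y * \<sigma> x)"
    "f (\<sigma> x * \<sigma> y) = - f (y * x)"
  using f_sigma[of "\<sigma> y * x"] f_sigma[of "y * \<sigma> x"] f_sigma[of "y * x"]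
  by (simp_all add: anti)

text \<open>\<open>F (a * y * x) - F (a * \<sigma> y * x)\<close> is evaluated by
  \<open>F_swap\<close>, followed by the equation at \<open>x * a\<close> and \<open>y\<close>, and
  also by \<open>F_shift_left\<close>. Equating the results gives an identity between values of
  \<open>f\<close> with error \<open>r\<close>. Integrated in \<open>a\<close>, it contains
  \<open>c\<close> times a difference of \<open>F\<close> values that \<open>F_shift_left\<close>
  expands again, with error \<open>e\<close>. The map \<open>p\<close> allows both \<open>a\<close>
  and \<open>\<sigma> a\<close> later.\<close>

lemma F_compare_bounded:
  assumes anti: "\<And>x y. \<sigma> (x * y) = \<sigma> y * \<sigma> x"
    and c: "\<And>u. F (\<sigma> u) = F u + c * f u"
  shows "bounded (range (\<lambda>a. f y * (F (p a * \<sigma> x) + F (x * p a))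
      - F (p a) * (f (y * x) - f (\<sigma> y * x))
      + c * (f (p a * x) * f y - f (p a) * (f (x * y) - f (x * \<sigma> y)))))"
    (is "bounded (range ?g)")
proof -
  define r where "r a = err x (a * y) - err (a * y) x - err x (a * \<sigma> y) + err (a * \<sigma> y) x
      - err (x * a) y - err (a * \<sigma> x) y + err a (y * x) - err a (\<sigma> y * x)" for a
  define e where "e a = err (a * x) y - err a (y * \<sigma> x) + err a (\<sigma> y * \<sigma> x)" for a
  have r: "r a = 2 * f y * (f (a * \<sigma> x) + f (x * a)) - 2 * f a * (f (y * x) - f (\<sigma> y * x))
      - c * (f (a * \<sigma> y * \<sigma> x) - f (a * y * \<sigma> x))" for a
  proof -
    have "F (a * y * x) = F (x * (a * y)) - c * f (a * y * \<sigma> x)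
        + err x (a * y) - err (a * y) x"
      using F_swap[OF anti c, of "a * y" x] f_sigma_left(2)[OF anti, of x "a * y"] by simp
    moreover have "F (a * \<sigma> y * x) = F (x * (a * \<sigma> y)) - c * f (a * \<sigma> y * \<sigma> x)
        + err x (a * \<sigma> y) - err (a * \<sigma> y) x"
      using F_swap[OF anti c, of "a * \<sigma> y" x] f_sigma_left(2)[OF anti, of x "a * \<sigma> y"] by simp
    moreover have "F (x * (a * \<sigma> y)) = F (x * (a * y)) + 2 * f (x * a) * f y + err (x * a) y"
      using F_eq[of "x * a" y] by (simp add: mult.assoc)
    moreover note F_shift_left[OF anti, of a y x]
    ultimately show ?thesis
      unfolding r_def by algebra
  qed
  have sum_r: "(\<Sum>i\<in>I. \<alpha> i * r (a * z i)) = 2 * f y * (F (a * \<sigma> x) + F (x * a))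
      - 2 * F a * (f (y * x) - f (\<sigma> y * x))
      - c * (F (a * \<sigma> y * \<sigma> x) - F (a * y * \<sigma> x))" for a
    unfolding r mult.assoc[of a "\<sigma> y"] mult.assoc[of a y] mult.assoc[of "a * z _"] F_mult[of a]
      mult.assoc[of x, symmetric] F_def[of "x * a"] F_def[of a]
    by (simp add: sum_distrib_left sum_distrib_right algebra_simps sum.distrib sum_subtractf)
  have e: "F (a * y * \<sigma> x) - F (a * \<sigma> y * \<sigma> x)
    = 2 * f (a * x) * f y - 2 * f a * (f (x * y) - f (x * \<sigma> y)) + e a" for a
    unfolding e_def F_shift_left[OF anti]
    using f_sigma_left[OF anti, of y x] by (simp add: algebra_simps)
  have "bounded (range (\<lambda>a. (1/2) * ((\<Sum>i\<in>I. \<alpha> i * r (p a * z i)) - c * e (p a))))"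
    unfolding r_def e_def by (intro bounded_intros)
  also have "(\<lambda>a. (1/2) * ((\<Sum>i\<in>I. \<alpha> i * r (p a * z i)) - c * e (p a))) = ?g"
  proof
    fix a
    have e_eq: "e (p a) = F (p a * y * \<sigma> x) - F (p a * \<sigma> y * \<sigma> x)
      - (2 * f (p a * x) * f y - 2 * f (p a) * (f (x * y) - f (x * \<sigma> y)))"
      unfolding e by simp
    show "(1/2) * ((\<Sum>i\<in>I. \<alpha> i * r (p a * z i)) - c * e (p a)) = ?g a"
      unfolding sum_r e_eq by (simp add: field_simps)
  qed
  finally show ?thesis .
qed

lemma f_antisymmetric:
  assumes anti: "\<And>x y. \<sigma> (x * y) = \<sigma> y * \<sigma> x"
    and c: "\<And>u. F (\<sigma> u) = F u + c * f u"
  shows "c * (f (x * y) - f (x * \<sigma> y) + f (y * x) - f (\<sigma> y * x)) = 0"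
proof -
  let ?J = "\<lambda>p x a. f y * (F (p a * \<sigma> x) + F (x * p a))
      - F (p a) * (f (y * x) - f (\<sigma> y * x))
      + c * (f (p a * x) * f y - f (p a) * (f (x * y) - f (x * \<sigma> y)))"
  \<comment> \<open>Subtracting the version for \<open>\<sigma> a\<close> turns all \<open>F\<close>
    values into \<open>c\<close> times values of \<open>f\<close>. Replacing \<open>x\<close> by
    \<open>\<sigma> x\<close> exchanges \<open>f (y * x) - f (\<sigma> y * x)\<close> with
    \<open>f (x * y) - f (x * \<sigma> y)\<close>; in the sum all terms containing
    \<open>f y\<close> as a factor cancel.\<close>
  have "bounded (range (\<lambda>a. - 1 * (?J (\<lambda>a. a) x a - ?J \<sigma> x a
      + (?J (\<lambda>a. a) (\<sigma> x) a - ?J \<sigma> (\<sigma> x) a))))"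
    by (intro bounded_intros F_compare_bounded[OF anti c])
  also have "(\<lambda>a. - 1 * (?J (\<lambda>a. a) x a - ?J \<sigma> x a
      + (?J (\<lambda>a. a) (\<sigma> x) a - ?J \<sigma> (\<sigma> x) a)))
    = (\<lambda>a. f a * (c * (f (x * y) - f (x * \<sigma> y) + f (y * x) - f (\<sigma> y * x))))"
  proof
    fix a
    have F: "F (\<sigma> a * \<sigma> x) = F (x * a) + c * f (x * a)"
      "F (x * \<sigma> a) = F (a * \<sigma> x) + c * f (a * \<sigma> x)"
      "F (\<sigma> a * x) = F (\<sigma> x * a) + c * f (\<sigma> x * a)"
      "F (\<sigma> x * \<sigma> a) = F (a * x) + c * f (a * x)"
      using c[of "x * a"] c[of "a * \<sigma> x"] c[of "\<sigma> x * a"] c[of "a * x"]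
      by (simp_all add: anti)
    have f: "f (\<sigma> a * x) = - f (\<sigma> x * a)" "f (\<sigma> a * \<sigma> x) = - f (x * a)"
      "f (\<sigma> x * y) = - f (\<sigma> y * x)" "f (\<sigma> x * \<sigma> y) = - f (y * x)"
      "f (y * \<sigma> x) = - f (x * \<sigma> y)" "f (\<sigma> y * \<sigma> x) = - f (x * y)"
      using f_sigma_left[OF anti] by blast+
    show "- 1 * (?J (\<lambda>a. a) x a - ?J \<sigma> x a
      + (?J (\<lambda>a. a) (\<sigma> x) a - ?J \<sigma> (\<sigma> x) a))
      = f a * (c * (f (x * y) - f (x * \<sigma> y) + f (y * x) - f (\<sigma> y * x)))"
      unfolding involution F f c f_sigma by (simp add: algebra_simps)
  qed
  finally show ?thesis
    by (rule eq_0_if_bounded)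
qed

lemma F_sigma_antiautomorphism:
  assumes anti: "\<And>x y. \<sigma> (x * y) = \<sigma> y * \<sigma> x"
  shows "F (\<sigma> u) = F u"
proof -
  obtain c where c: "\<And>u. F (\<sigma> u) = F u + c * f u"
    using F_sigma_diff_proportional by blast
  show ?thesis
  proof (cases "c = 0")
    case False
    define r where "r x y = err (\<sigma> y) x - err x (\<sigma> y) - err x y - err y x" for x y
    have f_anti: "f (\<sigma> y * x) = f (x * y) - f (x * \<sigma> y) + f (y * x)" for x y
      using f_antisymmetric[OF anti c, of x y] False by simp
    have F_anti: "F (\<sigma> y * x) = F (x * y) - F (x * \<sigma> y) + F (y * x)" for x y
    proof -
      have "F (\<sigma> y * x) = (\<Sum>i\<in>I. \<alpha> i * f (\<sigma> y * (x * z i)))"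
        by (simp add: F_def mult.assoc)
      also have "\<dots> = F (x * y) - F (x * \<sigma> y) + F (y * x)"
        unfolding f_anti F_mult[of x] F_def[of "y * x"] mult.assoc[of y x]
        by (simp add: distrib_left right_diff_distrib sum.distrib sum_subtractf)
      finally show ?thesis .
    qed
    \<comment> \<open>All \<open>F\<close> terms of \<open>F_anti\<close> are reduced by
      \<open>F_swap\<close> and the approximate equation, leaving products and multiples of
      \<open>c\<close>.\<close>
    have r: "r x y = 4 * f x * f y + c * (f (x * y) - f (x * \<sigma> y))" for x y
      using F_anti[of y x] F_swap[OF anti c, of y x] F_swap[OF anti c, of "\<sigma> y" x] F_eq[of x y]
      by (simp add: r_def algebra_simps)
    have "4 * F x - 2 * c * f x = 0" for x
    proof (rule eq_0_if_bounded)
      \<comment> \<open>The identity \<open>r\<close> is integrated in \<open>x\<close>, while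
        \<open>y\<close> is the variable that runs to infinity in \<open>f\<close>.\<close>
      have "bounded (range (\<lambda>y. (\<Sum>i\<in>I. \<alpha> i * r (x * z i) y) + c * err x y))"
        unfolding r_def by (intro bounded_intros)
      also have "(\<lambda>y. (\<Sum>i\<in>I. \<alpha> i * r (x * z i) y) + c * err x y)
        = (\<lambda>y. f y * (4 * F x - 2 * c * f x))"
      proof
        fix y
        have "(\<Sum>i\<in>I. \<alpha> i * r (x * z i) y) = 4 * F x * f y + c * (F (x * y) - F (x * \<sigma> y))"
          unfolding r F_mult F_def[of x]
          by (simp add: sum_distrib_left sum_distrib_right algebra_simps sum.distrib sum_subtractf)
        then show "(\<Sum>i\<in>I. \<alpha> i * r (x * z i) y) + c * err x y = f y * (4 * F x - 2 * c * f x)"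
          by (simp add: err_def algebra_simps)
      qed
      finally show "bounded (range (\<lambda>y. f y * (4 * F x - 2 * c * f x)))" .
    qed
    then have "4 * F u = 2 * c * f u" "4 * F (\<sigma> u) = 2 * c * f (\<sigma> u)"
      by (metis eq_iff_diff_eq_0)+
    with c[of u] have "c * f u = 0"
      unfolding f_sigma by algebra
    with c show ?thesis
      by simp
  qed (simp add: c)
qed

section \<open>From invariance of \<open>F\<close> to the exact equation\<close>

lemma F_sigma_eq: "F (\<sigma> u) = F u"
  using morphism F_sigma_automorphism F_sigma_antiautomorphism
  unfolding involutive_morphism_def by blast

lemma functional_equation: "F (x * \<sigma> y) - F (x * y) = 2 * f x * f y"
proof -
  have "bounded (range (\<lambda>w. f w * (F (x * \<sigma> y) - F (x * y) - 2 * f x * f y)))"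
  proof (cases "\<forall>x y. \<sigma> (x * y) = \<sigma> x * \<sigma> y")
    case True
    then have hom: "\<sigma> (x * y) = \<sigma> x * \<sigma> y" for x y
      by blast
    \<comment> \<open>The first two errors leave four \<open>F\<close> terms, which pair into the
      equation in \<open>y\<close> at \<open>w * \<sigma> x * \<sigma> t\<close> and at
      \<open>w * x * t\<close>.\<close>
    define r where "r w t = err w (x * y * t) - err w (x * \<sigma> y * t)
        - err (w * \<sigma> x * \<sigma> t) y - err (w * x * t) y" for w t
    have r: "r w (z i) = 2 * f w * (f (x * \<sigma> y * z i) - f (x * y * z i))
        + 2 * f y * (f (w * \<sigma> x * \<sigma> (z i)) + f (w * x * z i))" if "i \<in> I" for w i
      using that
      by (simp add: r_def err_def hom mult.assoc z_commute sigma_z_commute algebra_simps)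
    have "bounded (range (\<lambda>w. (1/2) * (\<Sum>i\<in>I. \<alpha> i * r w (z i)) + f y * err w x))"
      unfolding r_def by (intro bounded_intros)
    also have "(\<lambda>w. (1/2) * (\<Sum>i\<in>I. \<alpha> i * r w (z i)) + f y * err w x)
      = (\<lambda>w. f w * (F (x * \<sigma> y) - F (x * y) - 2 * f x * f y))"
    proof
      fix w
      have "(\<Sum>i\<in>I. \<alpha> i * r w (z i)) = (\<Sum>i\<in>I. \<alpha> i * (
        2 * f w * (f (x * \<sigma> y * z i) - f (x * y * z i))
        + 2 * f y * (f (w * \<sigma> x * \<sigma> (z i)) + f (w * x * z i))))"
        by (intro sum.cong) (simp_all add: r)
      also have "\<dots> = 2 * f w * (F (x * \<sigma> y) - F (x * y))
        + 2 * f y * (- F (\<sigma> (w * \<sigma> x)) + F (w * x))"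
        unfolding F_sigma unfolding F_def
        by (simp add: sum_distrib_left algebra_simps sum.distrib sum_subtractf)
      finally have sum_r: "(\<Sum>i\<in>I. \<alpha> i * r w (z i)) = 2 * f w * (F (x * \<sigma> y) - F (x * y))
        + 2 * f y * (- F (\<sigma> (w * \<sigma> x)) + F (w * x))" .
      show "(1/2) * (\<Sum>i\<in>I. \<alpha> i * r w (z i)) + f y * err w x
        = f w * (F (x * \<sigma> y) - F (x * y) - 2 * f x * f y)"
        \<comment> \<open>Invariance turns the second summand of \<open>sum_r\<close> into the
          equation at \<open>w\<close> and \<open>x\<close>, which supplies the product
          \<open>f w * f x\<close>.\<close>
        unfolding sum_r F_sigma_eq F_eq[of w x] by (simp add: field_simps)
    qed
    finally show ?thesis .
  next
    case False
    then have anti: "\<sigma> (x * y) = \<sigma> y * \<sigma> x" for x y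
      using morphism by (auto simp: involutive_morphism_def)
    have swap: "F (y * x) = F (x * y) + err x y - err y x" for x y
      using F_swap[OF anti, of 0 y x] F_sigma_eq by simp
    \<comment> \<open>As \<sigma> reverses products, \<open>y\<close> now stands left of
      \<open>\<sigma> x\<close>. Two uses of \<open>swap\<close> bring \<open>\<sigma> x\<close> to
      the front, so that the equation in \<open>y\<close> applies at
      \<open>\<sigma> x * w * \<sigma> t\<close>; the middle four errors pay for this.\<close>
    define r where "r w t = err w (x * y * t) - err w (x * \<sigma> y * t)
        + err (\<sigma> x) (w * y * \<sigma> t) - err (w * y * \<sigma> t) (\<sigma> x)
        - err (\<sigma> x) (w * \<sigma> y * \<sigma> t) + err (w * \<sigma> y * \<sigma> t) (\<sigma> x)
        - err (\<sigma> x * w * \<sigma> t) y - err (w * x * t) y" for w t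
    have r: "r w (z i) = 2 * f w * (f (x * \<sigma> y * z i) - f (x * y * z i))
        + 2 * f y * (f (\<sigma> x * w * \<sigma> (z i)) + f (w * x * z i))" if "i \<in> I" for w i
    proof -
      have "F (w * y * \<sigma> x * \<sigma> (z i)) = F (\<sigma> x * w * \<sigma> (z i) * y)
          + err (\<sigma> x) (w * y * \<sigma> (z i)) - err (w * y * \<sigma> (z i)) (\<sigma> x)"
        using swap[of "w * y * \<sigma> (z i)" "\<sigma> x"] that
        by (simp add: mult.assoc sigma_z_commute)
      moreover have "F (w * \<sigma> y * \<sigma> x * \<sigma> (z i)) = F (\<sigma> x * w * \<sigma> (z i) * \<sigma> y)
          + err (\<sigma> x) (w * \<sigma> y * \<sigma> (z i)) - err (w * \<sigma> y * \<sigma> (z i)) (\<sigma> x)"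
        using swap[of "w * \<sigma> y * \<sigma> (z i)" "\<sigma> x"] that
        by (simp add: mult.assoc sigma_z_commute)
      moreover have "F (w * y * \<sigma> x * \<sigma> (z i)) = F (w * x * z i * \<sigma> y)
          + 2 * f w * f (x * \<sigma> y * z i) + err w (x * \<sigma> y * z i)"
        using F_eq[of w "x * \<sigma> y * z i"] that
        by (simp add: anti mult.assoc z_commute sigma_z_commute)
      moreover have "F (w * \<sigma> y * \<sigma> x * \<sigma> (z i)) = F (w * x * z i * y)
          + 2 * f w * f (x * y * z i) + err w (x * y * z i)"
        using F_eq[of w "x * y * z i"] that
        by (simp add: anti mult.assoc z_commute sigma_z_commute)
      moreover note F_eq[of "\<sigma> x * w * \<sigma> (z i)" y] F_eq[of "w * x * z i" y]
      ultimately show ?thesis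
        unfolding r_def by algebra
    qed
    have "bounded (range (\<lambda>w. (1/2) * (\<Sum>i\<in>I. \<alpha> i * r w (z i))
        + f y * (err w x + err w (\<sigma> x) - err (\<sigma> x) w)))"
      unfolding r_def by (intro bounded_intros)
    also have "(\<lambda>w. (1/2) * (\<Sum>i\<in>I. \<alpha> i * r w (z i))
        + f y * (err w x + err w (\<sigma> x) - err (\<sigma> x) w))
      = (\<lambda>w. f w * (F (x * \<sigma> y) - F (x * y) - 2 * f x * f y))"
    proof
      fix w
      have "(\<Sum>i\<in>I. \<alpha> i * r w (z i)) = (\<Sum>i\<in>I. \<alpha> i * (
        2 * f w * (f (x * \<sigma> y * z i) - f (x * y * z i))
        + 2 * f y * (f (\<sigma> x * w * \<sigma> (z i)) + f (w * x * z i))))"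
        by (intro sum.cong) (simp_all add: r)
      also have "\<dots> = 2 * f w * (F (x * \<sigma> y) - F (x * y))
        + 2 * f y * (- F (\<sigma> (\<sigma> x * w)) + F (w * x))"
        unfolding F_sigma unfolding F_def
        by (simp add: sum_distrib_left algebra_simps sum.distrib sum_subtractf)
      finally have sum_r: "(\<Sum>i\<in>I. \<alpha> i * r w (z i)) = 2 * f w * (F (x * \<sigma> y) - F (x * y))
        + 2 * f y * (- F (\<sigma> (\<sigma> x * w)) + F (w * x))" .
      show "(1/2) * (\<Sum>i\<in>I. \<alpha> i * r w (z i))
        + f y * (err w x + err w (\<sigma> x) - err (\<sigma> x) w)
        = f w * (F (x * \<sigma> y) - F (x * y) - 2 * f x * f y)"
        unfolding sum_r F_sigma_eq swap[of "\<sigma> x" w] F_eq[of w x] by (simp add: field_simps)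
    qed
    finally show ?thesis .
  qed
  then show ?thesis
    using eq_0_if_bounded by fastforce
qed

end

section \<open>Total variation and the bound for bounded solutions\<close>

lemma norm_dirac_comb_integral_le:
  assumes "finite I" and h: "\<And>t. norm (h t) \<le> B"
  shows "norm (dirac_comb_integral I \<alpha> z h) \<le> total_variation (dirac_comb I \<alpha> z) * B"
proof -
  let ?\<mu> = "dirac_comb I \<alpha> z"
  let ?Z = "z ` I"
  \<comment> \<open>The points of the support as singletons, and the rest of the space unless it is
    empty, since no partition contains the empty set. Coinciding \<open>z i\<close> are grouped, so
    cancellation among their weights is respected.\<close>
  define P where "P = (\<lambda>t. {t}) ` ?Z \<union> ({- ?Z} - {{}})"
  have "finite P" and partition: "partition_on UNIV P"
    using \<open>finite I\<close> by (auto simp: P_def partition_on_def disjoint_def)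
  have "(\<Sum>t\<in>?Z. norm (?\<mu> {t})) = (\<Sum>A\<in>(\<lambda>t. {t}) ` ?Z. norm (?\<mu> A))"
    by (subst sum.reindex) (auto simp: inj_on_def)
  also have "\<dots> \<le> (\<Sum>A\<in>P. norm (?\<mu> A))"
    using \<open>finite P\<close> by (intro sum_mono2) (auto simp: P_def)
  also have "\<dots> \<le> total_variation ?\<mu>"
    unfolding total_variation_def
    using \<open>finite P\<close> partition
    by (intro cSUP_upper bdd_aboveI2[where M = "\<Sum>i\<in>I. norm (\<alpha> i)"] norm_sum_dirac_comb_le) auto
  finally have tv: "(\<Sum>t\<in>?Z. norm (?\<mu> {t})) \<le> total_variation ?\<mu>" .
  have "0 \<le> B"
    using h norm_ge_zero order_trans by blast
  have "dirac_comb_integral I \<alpha> z h = (\<Sum>t\<in>?Z. \<Sum>i\<in>{i\<in>I. z i = t}. \<alpha> i * h (z i))"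
    unfolding dirac_comb_integral_def using \<open>finite I\<close> by (rule sum.image_gen)
  also have "\<dots> = (\<Sum>t\<in>?Z. ?\<mu> {t} * h t)"
  proof (intro sum.cong refl)
    fix t
    have "?\<mu> {t} = (\<Sum>i\<in>I. if z i = t then \<alpha> i else 0)"
      unfolding dirac_comb_def by (intro sum.cong) (auto simp: measure_return)
    then show "(\<Sum>i\<in>{i\<in>I. z i = t}. \<alpha> i * h (z i)) = ?\<mu> {t} * h t"
      using \<open>finite I\<close> by (simp add: sum.inter_filter sum_distrib_right if_distrib if_distribR
          cong: if_cong)
  qed
  finally have "norm (dirac_comb_integral I \<alpha> z h) \<le> (\<Sum>t\<in>?Z. norm (?\<mu> {t}) * B)"
    by (auto intro!: order.trans[OF norm_sum] sum_mono mult_left_mono h simp: norm_mult)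
  also have "\<dots> \<le> total_variation ?\<mu> * B"
    using tv \<open>0 \<le> B\<close> by (simp add: sum_distrib_right[symmetric] mult_right_mono)
  finally show ?thesis .
qed

lemma bounded_solution_bound:
  fixes f :: "'a::semigroup_mult \<Rightarrow> complex"
  assumes "finite I" "bounded (range f)"
    and approx: "\<And>x y. norm (dirac_comb_integral I \<alpha> z (\<lambda>t. f (x * \<sigma> y * t))
                 - dirac_comb_integral I \<alpha> z (\<lambda>t. f (x * y * t)) - 2 * f x * f y) \<le> \<delta>"
  shows "norm (f x) \<le> (total_variation (dirac_comb I \<alpha> z)
    + sqrt ((total_variation (dirac_comb I \<alpha> z))\<^sup>2 + 2 * \<delta>)) / 2"
proof -
  define v where "v = total_variation (dirac_comb I \<alpha> z)"
  define B where "B = (SUP x. norm (f x))"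
  have "bdd_above (range (\<lambda>x. norm (f x)))"
    using assms(2) by (auto simp: bounded_iff bdd_above_def)
  then have B: "norm (f x) \<le> B" for x
    unfolding B_def by (intro cSUP_upper) auto
  then have "0 \<le> B"
    using norm_ge_zero order_trans by blast
  have sq: "(norm (f x))\<^sup>2 \<le> \<delta> / 2 + v * B" for x
  proof -
    let ?p = "dirac_comb_integral I \<alpha> z (\<lambda>t. f (x * \<sigma> x * t))"
    let ?q = "dirac_comb_integral I \<alpha> z (\<lambda>t. f (x * x * t))"
    have "norm ?p \<le> v * B" "norm ?q \<le> v * B"
      unfolding v_def by (intro norm_dirac_comb_integral_le assms B)+
    moreover have "norm (2 * f x * f x) \<le> norm (?p - ?q - 2 * f x * f x) + norm ?p + norm ?q"
      by norm
    moreover note approx[of x x]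
    ultimately show ?thesis
      by (simp add: norm_mult power2_eq_square)
  qed
  have "B \<le> sqrt (\<delta> / 2 + v * B)"
    unfolding B_def using sq B_def by (intro cSUP_least) (auto intro: real_le_rsqrt)
  moreover have "0 \<le> \<delta> / 2 + v * B"
    using sq zero_le_power2 order_trans by blast
  ultimately have "B\<^sup>2 \<le> \<delta> / 2 + v * B"
    using \<open>0 \<le> B\<close> by (metis power_mono real_sqrt_pow2)
  \<comment> \<open>Completing the square: the left side is
    \<open>4 * (B\<^sup>2 - v * B) + v\<^sup>2\<close>.\<close>
  then have "(2 * B - v)\<^sup>2 \<le> v\<^sup>2 + 2 * \<delta>"
    by (simp add: power2_eq_square algebra_simps)
  then have "2 * B - v \<le> sqrt (v\<^sup>2 + 2 * \<delta>)"
    by (rule real_le_rsqrt)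
  then show ?thesis
    using B[of x] by (simp add: v_def)
qed

theorem theorem5p2:
  fixes \<sigma> :: "'a::semigroup_mult \<Rightarrow> 'a"
    and I :: "'i set" and \<alpha> :: "'i \<Rightarrow> complex" and z :: "'i \<Rightarrow> 'a"
    and \<mu> :: "'a set \<Rightarrow> complex"
    and \<delta> :: real and f :: "'a \<Rightarrow> complex"
  assumes "involutive_morphism \<sigma>"
    and "finite I" and "\<And>i. i \<in> I \<Longrightarrow> z i \<in> semigroup_center"
    and "\<mu> = dirac_comb I \<alpha> z"
    and "\<delta> > 0"
    and "\<And>x y. norm (dirac_comb_integral I \<alpha> z (\<lambda>t. f (x * \<sigma> y * t))
                 - dirac_comb_integral I \<alpha> z (\<lambda>t. f (x * y * t)) - 2 * f x * f y) \<le> \<delta>"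
  shows "(bounded (range f) \<and>
            (\<forall>x. norm (f x) \<le>
               (total_variation \<mu> + sqrt ((total_variation \<mu>)\<^sup>2 + 2 * \<delta>)) / 2)) \<or>
         (\<forall>x y. dirac_comb_integral I \<alpha> z (\<lambda>t. f (x * \<sigma> y * t))
                 - dirac_comb_integral I \<alpha> z (\<lambda>t. f (x * y * t)) = 2 * f x * f y)"
proof (cases "bounded (range f)")
  case True
  then show ?thesis
    using bounded_solution_bound[OF assms(2) True assms(6)] assms(4) by simp
next
  case False
  interpret van_vleck_superstability \<sigma> I \<alpha> z \<delta> f
    using assms False by unfold_locales auto
  show ?thesis
    using functional_equation by (simp add: F_def dirac_comb_integral_def)
qed

end
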